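(* Let $V$ be a finite set partitioned into two nonempty disjoint subsets $V_1$ and $V_2$, let $s$ be an integer with $2\le s\le |V|$, and let $\mathcal{G}_s(V,E)$ be the $s$-uniform complete bipartite hypergraph on $V=V_1\cup V_2$. Let $K$ be a field and let $I_s\subset K[x_1,\dots,x_{|V|}]$ be the edge ideal of $\mathcal{G}_s(V,E)$. Then $$s\le \operatorname{sdepth}(I_s)\le s+\frac{\binom{|V|}{s+1}-\binom{|V_1|}{s+1}-\binom{|V_2|}{s+1}}{\binom{|V|}{s}-\binom{|V_1|}{s}-\binom{|V_2|}{s}}.$$
   Context: Binomial coefficients $\binom{a}{b}$ with $a<b$ are $0$. A hypergraph on a finite vertex set $V$ is given by a collection $E$ of distinct nonempty subsets of $V$ (the edges); it is $s$-uniform if every edge has cardinality $s$. The $s$-uniform complete bipartite hypergraph $\mathcal{G}_s(V,E)$ on $V=V_1\cup V_2$ (disjoint union) is the $s$-uniform hypergraph whose edges are exactly the $s$-element subsets $F$ of $V$ such that $F\cap V_j\ne F$ for $j=1,2$ (i.e. $F\not\subset V_1$ and $F\not\subset V_2$). Writing $V=\{v_1,\dots,v_t\}$, the edge ideal of a hypergraph with edge set $E$ is the ideal of $S=K[x_1,\dots,x_t]$ generated by the monomials $\prod_{v_i\in F}x_i$, $F\in E$. Stanley depth: let $S=K[x_1,\dots,x_t]$ and let $M$ be a finitely generated $\mathbb{Z}^t$-graded $S$-module. For a homogeneous element $u\in M$ and a subset $Z\subset\{x_1,\dots,x_t\}$, let $uK[Z]$ be the $K$-subspace of $M$ consisting of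 all elements $uf$ with $f\in K[Z]$. It is called a Stanley space of dimension $|Z|$ if $uK[Z]$ is a free $K[Z]$-module. A Stanley decomposition of $M$ is a presentation of the $K$-vector space $M$ as a finite direct sum of Stanley spaces $\mathcal{D}: M=\bigoplus_{i=1}^r u_iK[Z_i]$. Put $\operatorname{sdepth}(\mathcal{D})=\min\{|Z_i|: i=1,\dots,r\}$ and $\operatorname{sdepth}(M)=\max\{\operatorname{sdepth}(\mathcal{D}):\mathcal{D}\text{ is a Stanley decomposition of }M\}$. *)

theory Defs
  imports Complex_Main "HOL-Library.Poly_Mapping" "HOL-Library.FuncSet"
begin

text \<open>
  The variables are indexed by a finite vertex type \<open>'v\<close>, so the whole type
  \<open>('v, 'k) mpoly\<close> is the polynomial ring \<open>S = K[x\<^sub>v : v \<in> V]\<close> with \<open>V = UNIV\<close>;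
  exponent vectors are finitely supported functions \<open>'v \<Rightarrow>\<^sub>0 nat\<close>.
\<close>

type_synonym ('v, 'k) mpoly = "('v \<Rightarrow>\<^sub>0 nat) \<Rightarrow>\<^sub>0 'k"

definition var :: "'v \<Rightarrow> ('v, 'k::field) mpoly" where
  "var v = Poly_Mapping.single (Poly_Mapping.single v 1) 1"

definition polys_in :: "'v set \<Rightarrow> ('v, 'k::field) mpoly set"  (\<open>K[_]\<close>) where
  "K[Z] = {f. \<forall>a \<in> Poly_Mapping.keys f. Poly_Mapping.keys a \<subseteq> Z}"

text \<open>The component of \<open>S\<close> of multidegree \<open>a\<close>; it is \<open>{0}\<close> unless \<open>a \<ge> 0\<close>.\<close>

definition mdeg_part :: "('v \<Rightarrow> int) \<Rightarrow> ('v, 'k::field) mpoly set" where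
  "mdeg_part a = {f. \<forall>b \<in> Poly_Mapping.keys f. \<forall>v. int (Poly_Mapping.lookup b v) = a v}"


section \<open>Hypergraphs and edge ideals\<close>

definition complete_bipartite_edges :: "nat \<Rightarrow> 'v set \<Rightarrow> 'v set \<Rightarrow> 'v set set" where
  "complete_bipartite_edges s V1 V2 =
     {F. F \<subseteq> V1 \<union> V2 \<and> card F = s \<and> F \<inter> V1 \<noteq> F \<and> F \<inter> V2 \<noteq> F}"

definition edge_ideal :: "'v set set \<Rightarrow> ('v, 'k::field) mpoly set" where
  "edge_ideal E = module.span (*) ((\<lambda>F. \<Prod>v\<in>F. var v) ` E)"


section \<open>Stanley depth\<close>

text \<open>
  Freeness over a subring \<open>A\<close> of the ring \<open>'r\<close>: the set \<open>N\<close>, assumed to be an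
  \<open>A\<close>-submodule of \<open>'m\<close>, has a basis \<open>B\<close>.
\<close>

definition free_over ::
  "'r::comm_ring_1 set \<Rightarrow> ('r \<Rightarrow> 'm \<Rightarrow> 'm) \<Rightarrow> 'm::ab_group_add set \<Rightarrow> bool" where
  "free_over A scale N \<longleftrightarrow>
     (\<exists>B \<subseteq> N. \<forall>m \<in> N. \<exists>!c :: 'm \<Rightarrow>\<^sub>0 'r.
        Poly_Mapping.keys c \<subseteq> B \<and> (\<forall>b. Poly_Mapping.lookup c b \<in> A) \<and> m = (\<Sum>b \<in> Poly_Mapping.keys c. scale (Poly_Mapping.lookup c b) b))"

definition stanley_set ::
  "(('v, 'k::field) mpoly \<Rightarrow> 'm \<Rightarrow> 'm) \<Rightarrow> 'm \<Rightarrow> 'v set \<Rightarrow> 'm set" where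
  "stanley_set scale u Z = (\<lambda>f. scale f u) ` K[Z]"

text \<open>
  A \<open>\<int>\<^sup>t\<close>-graded \<open>S\<close>-module is given by the action \<open>scale\<close> of \<open>S\<close>, its graded
  components \<open>G a\<close> (\<open>a \<in> \<int>\<^sup>t\<close>) and its carrier \<open>M\<close>.
  A decomposition is a list of pairs \<open>(u\<^sub>i, Z\<^sub>i)\<close>; the bijectivity of summation says
  that \<open>M\<close> is the internal direct sum of the spaces \<open>u\<^sub>i K[Z\<^sub>i]\<close>.
\<close>

definition stanley_decomposition ::
  "(('v::finite, 'k::field) mpoly \<Rightarrow> 'm \<Rightarrow> 'm) \<Rightarrow> (('v \<Rightarrow> int) \<Rightarrow> 'm set) \<Rightarrow>
   'm::ab_group_add set \<Rightarrow> ('m \<times> 'v set) list \<Rightarrow> bool" where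
  "stanley_decomposition scale G M D \<longleftrightarrow>
     (\<forall>(u, Z) \<in> set D. u \<in> M \<and> (\<exists>a. u \<in> G a) \<and> free_over K[Z] scale (stanley_set scale u Z)) \<and>
     bij_betw (\<lambda>w. \<Sum>i<length D. w i)
       (\<Pi>\<^sub>E i \<in> {..<length D}. stanley_set scale (fst (D ! i)) (snd (D ! i))) M"

definition sdepth_decomposition :: "('m \<times> 'v set) list \<Rightarrow> nat" where
  "sdepth_decomposition D = Min ((\<lambda>(u, Z). card Z) ` set D)"

text \<open>
  For \<open>M \<noteq> {0}\<close> the maximum is over a set of numbers bounded by \<open>t\<close>; the value for the
  zero module, which has the empty decomposition, is not specified.
\<close>

definition sdepth ::
  "(('v::finite, 'k::field) mpoly \<Rightarrow> 'm \<Rightarrow> 'm) \<Rightarrow> (('v \<Rightarrow> int) \<Rightarrow> 'm set) \<Rightarrow>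
   'm::ab_group_add set \<Rightarrow> nat" where
  "sdepth scale G M = Max {sdepth_decomposition D | D. stanley_decomposition scale G M D}"

text \<open>A monomial ideal is a module by multiplication, with the grading inherited from \<open>S\<close>.\<close>

abbreviation sdepth_ideal :: "('v::finite, 'k::field) mpoly set \<Rightarrow> nat" where
  "sdepth_ideal I \<equiv> sdepth (*) (\<lambda>a. I \<inter> mdeg_part a) I"

end

theory Submission
  imports Defs "HOL-Library.Disjoint_Sets"
begin

text \<open>
  Both bounds come from looking at squarefree monomials \<open>x\<^sup>F\<close> and hold for every nonempty
  \<open>s\<close>-uniform hypergraph; only the final count uses the bipartite structure.

  Lower bound. A monomial lies in a squarefree monomial ideal iff its support contains an edge, so
  membership depends on the support alone. Sorting monomials by support gives the Stanley
  decomposition \<open>I = \<Oplus> x\<^sup>\<sigma> K[\<sigma>]\<close> over all vertex sets \<open>\<sigma>\<close> that contain an edge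
  (\<open>support_decomposition\<close>), and each such \<open>\<sigma>\<close> has at least \<open>s\<close> elements.

  Upper bound. Fix any Stanley decomposition \<open>I = \<Oplus> u\<^sub>i K[Z\<^sub>i]\<close>. The generators \<open>x\<^sup>F\<close> have the
  least degree occurring in \<open>I\<close>, so \<open>x\<^sup>F\<close> can only lie in a summand whose \<open>u\<^sub>i\<close> is \<open>x\<^sup>F\<close>
  itself, up to a scalar (\<open>generator_in_decomposition\<close>). For every \<open>v \<in> Z\<^sub>i - F\<close> that summand also
  contains the squarefree monomial \<open>x\<^sub>v x\<^sup>F\<close> of degree \<open>s + 1\<close>. If all \<open>|Z\<^sub>i| \<ge> d\<close>, every edge
  thus yields at least \<open>d - s\<close> of these, and directness of the sum makes them distinct for
  different edges. Hence \<open>(d - s) \<cdot> |E|\<close> is at most the number of \<open>(s + 1)\<close>-sets containing an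
  edge (\<open>sdepth_decomposition_bound\<close>).

  For the complete bipartite hypergraph, a set of size \<open>s + 1\<close> contains an edge iff it meets both
  parts, that is, iff it is an edge of the \<open>(s + 1)\<close>-uniform complete bipartite hypergraph. The
  edges of size \<open>k\<close> are the \<open>k\<close>-sets that lie in neither part, which gives the numerator and the
  denominator of the fraction.
\<close>

section \<open>Monomials in the polynomial ring\<close>

lemma poly_mapping_eq_sum_single:
  "f = (\<Sum>a\<in>Poly_Mapping.keys f. Poly_Mapping.single a (Poly_Mapping.lookup f a))"
  by (rule poly_mapping_eqI)
    (auto simp: lookup_sum lookup_single when_def in_keys_iff)

lemma single_eq_zero_iff: "Poly_Mapping.single a c = 0 \<longleftrightarrow> c = 0"
  by (metis lookup_single_eq lookup_zero single_zero)

text \<open>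
  Multiplication by a monomial shifts exponents and scales coefficients; read as a cancellation law,
  this is what makes the spaces \<open>u K[Z]\<close> with \<open>u\<close> a monomial free.
\<close>

lemma lookup_mult_single:
  fixes f :: "'a::cancel_comm_monoid_add \<Rightarrow>\<^sub>0 'b::comm_semiring_0"
  shows "Poly_Mapping.lookup (f * Poly_Mapping.single b c) (a + b) = Poly_Mapping.lookup f a * c"
proof -
  have "f * Poly_Mapping.single b c =
      (\<Sum>x\<in>Poly_Mapping.keys f. Poly_Mapping.single (x + b) (Poly_Mapping.lookup f x * c))"
    by (subst poly_mapping_eq_sum_single [of f]) (simp add: sum_distrib_right mult_single)
  then show ?thesis
    by (auto simp: lookup_sum lookup_single when_def in_keys_iff)
qed

definition sqfree_exp :: "'v set \<Rightarrow> 'v \<Rightarrow>\<^sub>0 nat" where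
  "sqfree_exp F = (\<Sum>v\<in>F. Poly_Mapping.single v 1)"

lemma lookup_sqfree_exp:
  "finite F \<Longrightarrow> Poly_Mapping.lookup (sqfree_exp F) v = (if v \<in> F then 1 else 0)"
  by (auto simp: sqfree_exp_def lookup_sum lookup_single when_def)

lemma keys_sqfree_exp: "finite F \<Longrightarrow> Poly_Mapping.keys (sqfree_exp F) = F"
  by (auto simp: in_keys_iff lookup_sqfree_exp split: if_splits)

lemma sqfree_exp_insert:
  "finite F \<Longrightarrow> v \<notin> F \<Longrightarrow> sqfree_exp (insert v F) = Poly_Mapping.single v 1 + sqfree_exp F"
  by (simp add: sqfree_exp_def)

lemma prod_var_eq_single:
  "finite F \<Longrightarrow> (\<Prod>v\<in>F. var v) = Poly_Mapping.single (sqfree_exp F) (1::'k::field)"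
  by (induction F rule: finite_induct) (simp_all add: sqfree_exp_def var_def mult_single)

lemma sqfree_exp_dvd:
  fixes a :: "'v::finite \<Rightarrow>\<^sub>0 nat"
  assumes "F \<subseteq> Poly_Mapping.keys a"
  obtains e where "a = e + sqfree_exp F" "Poly_Mapping.keys e \<subseteq> Poly_Mapping.keys a"
proof
  show "a = (a - sqfree_exp F) + sqfree_exp F"
  proof (rule poly_mapping_eqI)
    fix v
    show "Poly_Mapping.lookup a v = Poly_Mapping.lookup (a - sqfree_exp F + sqfree_exp F) v"
      using assms by (cases "v \<in> F")
        (auto simp: lookup_add lookup_minus lookup_sqfree_exp in_keys_iff Suc_le_eq)
  qed
  show "Poly_Mapping.keys (a - sqfree_exp F) \<subseteq> Poly_Mapping.keys a"
    by (auto simp: in_keys_iff lookup_minus)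
qed

text \<open>
  A multidegree determines its exponent vector, so a homogeneous component of the polynomial ring is
  at most one-dimensional. The zero polynomial is covered by \<open>c = 0\<close>.
\<close>

lemma homogeneous_eq_single:
  assumes "f \<in> mdeg_part a"
  obtains b c where "f = Poly_Mapping.single b c"
proof (cases "f = 0")
  case True
  then show ?thesis using that[of 0 0] by simp
next
  case False
  then obtain b where b: "b \<in> Poly_Mapping.keys f" by (metis in_keys_iff poly_mapping_eqI lookup_zero)
  have "x = b" if "x \<in> Poly_Mapping.keys f" for x
  proof (rule poly_mapping_eqI)
    fix v
    have "int (Poly_Mapping.lookup x v) = int (Poly_Mapping.lookup b v)"
      using assms that b by (simp add: mdeg_part_def)
    then show "Poly_Mapping.lookup x v = Poly_Mapping.lookup b v" by simp
  qed
  with b have "Poly_Mapping.keys f = {b}" by blast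
  then show ?thesis using that poly_mapping_eq_sum_single [of f] by simp
qed


section \<open>Squarefree monomial ideals\<close>

interpretation ring_module: module "(*) :: 'r::comm_ring_1 \<Rightarrow> 'r \<Rightarrow> 'r"
  by unfold_locales (simp_all add: algebra_simps)

text \<open>
  The polynomials all of whose monomials are divisible by some generator form an ideal that contains
  the generators; conversely each such monomial is visibly a multiple of a generator.
\<close>

lemma mem_edge_ideal_iff:
  fixes f :: "('v::finite, 'k::field) mpoly"
  shows "f \<in> edge_ideal E \<longleftrightarrow> (\<forall>a\<in>Poly_Mapping.keys f. \<exists>F\<in>E. F \<subseteq> Poly_Mapping.keys a)"
proof
  define M :: "('v, 'k) mpoly set"
    where "M = {f. \<forall>a\<in>Poly_Mapping.keys f. \<exists>F\<in>E. F \<subseteq> Poly_Mapping.keys a}"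
  have "ring_module.subspace M"
    unfolding ring_module.subspace_def
  proof (intro conjI ballI allI)
    show "0 \<in> M" by (simp add: M_def)
    show "f + g \<in> M" if "f \<in> M" "g \<in> M" for f g
      using that Poly_Mapping.keys_add[of f g] by (auto simp: M_def)
    show "c * f \<in> M" if "f \<in> M" for c f
    proof -
      have "\<exists>F\<in>E. F \<subseteq> Poly_Mapping.keys a" if "a \<in> Poly_Mapping.keys (c * f)" for a
      proof -
        obtain x y where "a = x + y" "y \<in> Poly_Mapping.keys f"
          using \<open>a \<in> Poly_Mapping.keys (c * f)\<close> keys_mult[of c f] by blast
        moreover from this obtain F where "F \<in> E" "F \<subseteq> Poly_Mapping.keys y"
          using \<open>f \<in> M\<close> by (auto simp: M_def)
        ultimately have "F \<subseteq> Poly_Mapping.keys a" by (auto simp: in_keys_iff lookup_add)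
        with \<open>F \<in> E\<close> show ?thesis by blast
      qed
      then show ?thesis by (simp add: M_def)
    qed
  qed
  moreover have "(\<lambda>F. \<Prod>v\<in>F. var v) ` E \<subseteq> M"
    by (auto simp: M_def prod_var_eq_single keys_sqfree_exp)
  ultimately have "edge_ideal E \<subseteq> M"
    unfolding edge_ideal_def by (rule ring_module.span_minimal[rotated])
  then show "\<forall>a\<in>Poly_Mapping.keys f. \<exists>F\<in>E. F \<subseteq> Poly_Mapping.keys a" if "f \<in> edge_ideal E"
    using that by (auto simp: M_def)
next
  assume *: "\<forall>a\<in>Poly_Mapping.keys f. \<exists>F\<in>E. F \<subseteq> Poly_Mapping.keys a"
  have "Poly_Mapping.single a (Poly_Mapping.lookup f a) \<in> edge_ideal E"
    if a: "a \<in> Poly_Mapping.keys f" for a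
  proof -
    obtain F where F: "F \<in> E" "F \<subseteq> Poly_Mapping.keys a" using * a by blast
    obtain e where "a = e + sqfree_exp F" using sqfree_exp_dvd F(2) .
    then have "Poly_Mapping.single a (Poly_Mapping.lookup f a) =
        Poly_Mapping.single e (Poly_Mapping.lookup f a) * (\<Prod>v\<in>F. var v)"
      by (simp add: prod_var_eq_single mult_single)
    then show ?thesis
      unfolding edge_ideal_def using F(1) by (auto intro: ring_module.span_scale ring_module.span_base)
  qed
  then show "f \<in> edge_ideal E"
    by (subst poly_mapping_eq_sum_single [of f]) (auto simp: edge_ideal_def intro: ring_module.span_sum)
qed

lemma single_mem_edge_ideal_iff:
  fixes c :: "'k::field" and a :: "'v::finite \<Rightarrow>\<^sub>0 nat"
  assumes "c \<noteq> 0"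
  shows "Poly_Mapping.single a c \<in> edge_ideal E \<longleftrightarrow> (\<exists>F\<in>E. F \<subseteq> Poly_Mapping.keys a)"
  using assms by (simp add: mem_edge_ideal_iff)


section \<open>Stanley spaces spanned by monomials\<close>

lemma zero_mem_stanley_set: "0 \<in> stanley_set (*) u Z"
  unfolding stanley_set_def by (rule image_eqI[of _ _ 0]) (auto simp: polys_in_def)

lemma single_mem_stanley_set:
  assumes "c \<noteq> 0" "Poly_Mapping.keys e \<subseteq> Z"
  shows "Poly_Mapping.single (e + b) d \<in> stanley_set (*) (Poly_Mapping.single b c) Z"
  unfolding stanley_set_def
  by (rule image_eqI[of _ _ "Poly_Mapping.single e (d / c)"])
    (use assms in \<open>auto simp: mult_single polys_in_def\<close>)

text \<open>
  The form in which Stanley spaces are used in the upper bound: every monomial occurring in an element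
  of \<open>u K[Z]\<close> is a multiple of the monomial \<open>u\<close> by variables from \<open>Z\<close>.
\<close>

lemma keys_stanley_set:
  assumes "f \<in> stanley_set (*) (Poly_Mapping.single b c) Z" "a \<in> Poly_Mapping.keys f"
  obtains e where "Poly_Mapping.keys e \<subseteq> Z" "a = e + b"
proof -
  obtain g where g: "g \<in> K[Z]" "f = g * Poly_Mapping.single b c"
    using assms(1) by (auto simp: stanley_set_def)
  with assms(2) keys_mult[of g "Poly_Mapping.single b c"]
  obtain e where "e \<in> Poly_Mapping.keys g" "a = e + b" by (auto split: if_splits)
  with g(1) that show ?thesis by (auto simp: polys_in_def)
qed

text \<open>
  The generator alone is a basis: multiplication by a monomial is injective, so the coefficient of
  the generator is determined by the element it represents.
\<close>

lemma free_over_monomial: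
  fixes b :: "'v \<Rightarrow>\<^sub>0 nat"
  shows "free_over K[Z] (*) (stanley_set (*) (Poly_Mapping.single b (1::'k::field)) Z)"
proof -
  let ?u = "Poly_Mapping.single b (1::'k)"
  have cancel: "f = g" if "f * ?u = g * ?u" for f g :: "('v, 'k) mpoly"
  proof (rule poly_mapping_eqI)
    fix a
    show "Poly_Mapping.lookup f a = Poly_Mapping.lookup g a"
      using that lookup_mult_single[of f b 1 a] lookup_mult_single[of g b 1 a] by simp
  qed
  have eval: "(\<Sum>x\<in>Poly_Mapping.keys c. Poly_Mapping.lookup c x * x) = Poly_Mapping.lookup c ?u * ?u"
    if "Poly_Mapping.keys c \<subseteq> {?u}" for c :: "('v, 'k) mpoly \<Rightarrow>\<^sub>0 ('v, 'k) mpoly"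
    by (subst sum.mono_neutral_left[of "{?u}"]) (use that in \<open>auto simp: in_keys_iff\<close>)
  have zero: "(0 :: ('v, 'k) mpoly) \<in> K[Z]" by (simp add: polys_in_def)
  have "?u \<in> stanley_set (*) ?u Z"
    using single_mem_stanley_set[of "1::'k" 0 Z b 1] by simp
  moreover have "\<exists>!c. Poly_Mapping.keys c \<subseteq> {?u} \<and> (\<forall>x. Poly_Mapping.lookup c x \<in> K[Z]) \<and>
      m = (\<Sum>x\<in>Poly_Mapping.keys c. Poly_Mapping.lookup c x * x)"
    if m: "m \<in> stanley_set (*) ?u Z" for m
  proof -
    obtain f where f: "f \<in> K[Z]" "m = f * ?u"
      using m by (auto simp: stanley_set_def)
    show ?thesis
    proof (rule ex1I[of _ "Poly_Mapping.single ?u f"])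
      have *: "Poly_Mapping.keys (Poly_Mapping.single ?u f) \<subseteq> {?u}" by simp
      have "Poly_Mapping.lookup (Poly_Mapping.single ?u f) x \<in> K[Z]" for x
        using f(1) zero unfolding lookup_single when_def by (cases "?u = x") simp_all
      moreover have "m = (\<Sum>x\<in>Poly_Mapping.keys (Poly_Mapping.single ?u f).
          Poly_Mapping.lookup (Poly_Mapping.single ?u f) x * x)"
        unfolding eval[OF *] using f(2) by (simp only: lookup_single_eq)
      ultimately show "Poly_Mapping.keys (Poly_Mapping.single ?u f) \<subseteq> {?u} \<and>
          (\<forall>x. Poly_Mapping.lookup (Poly_Mapping.single ?u f) x \<in> K[Z]) \<and>
          m = (\<Sum>x\<in>Poly_Mapping.keys (Poly_Mapping.single ?u f).
                Poly_Mapping.lookup (Poly_Mapping.single ?u f) x * x)"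
        using * by blast
    next
      fix c
      assume c: "Poly_Mapping.keys c \<subseteq> {?u} \<and> (\<forall>x. Poly_Mapping.lookup c x \<in> K[Z]) \<and>
          m = (\<Sum>x\<in>Poly_Mapping.keys c. Poly_Mapping.lookup c x * x)"
      then have keys: "Poly_Mapping.keys c \<subseteq> {?u}" by blast
      have "Poly_Mapping.lookup c ?u * ?u = f * ?u"
        using c f(2) eval[OF keys] by (metis (no_types))
      then have u: "Poly_Mapping.lookup c ?u = f" by (rule cancel)
      show "c = Poly_Mapping.single ?u f"
      proof (rule poly_mapping_eqI)
        fix x
        show "Poly_Mapping.lookup c x = Poly_Mapping.lookup (Poly_Mapping.single ?u f) x"
        proof (cases "x = ?u")
          case True
          then show ?thesis using u by simp
        next
          case False
          then have "x \<notin> Poly_Mapping.keys c" using keys by blast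
          with False show ?thesis by (simp add: in_keys_iff lookup_single_not_eq)
        qed
      qed
    qed
  qed
  ultimately show ?thesis
    unfolding free_over_def by (intro exI[of _ "{?u}"]) auto
qed

text \<open>
  Multiplying \<open>x\<^sup>\<sigma>\<close> by further variables from \<open>\<sigma>\<close> never changes the support, and every monomial
  with support \<open>\<sigma>\<close> arises in this way.
\<close>

lemma stanley_set_sqfree:
  fixes \<sigma> :: "'v::finite set"
  shows "stanley_set (*) (Poly_Mapping.single (sqfree_exp \<sigma>) (1::'k::field)) \<sigma> =
    {f. Poly_Mapping.keys f \<subseteq> {a. Poly_Mapping.keys a = \<sigma>}}" (is "?L = ?R")
proof
  show "?L \<subseteq> ?R"
  proof
    fix f assume f: "f \<in> ?L"
    have "Poly_Mapping.keys a = \<sigma>" if a: "a \<in> Poly_Mapping.keys f" for a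
    proof -
      obtain e where "Poly_Mapping.keys e \<subseteq> \<sigma>" "a = e + sqfree_exp \<sigma>"
        using keys_stanley_set[OF f a] by metis
      then show ?thesis
        by (auto simp: subset_iff in_keys_iff lookup_add lookup_sqfree_exp split: if_splits)
    qed
    then show "f \<in> ?R" by auto
  qed
next
  show "?R \<subseteq> ?L"
  proof
    fix f :: "('v, 'k) mpoly" assume f: "f \<in> ?R"
    have "\<exists>e. a = e + sqfree_exp \<sigma> \<and> Poly_Mapping.keys e \<subseteq> \<sigma>" if "a \<in> Poly_Mapping.keys f" for a
    proof -
      have a: "Poly_Mapping.keys a = \<sigma>" using f that by auto
      show ?thesis using sqfree_exp_dvd[of \<sigma> a] unfolding a by blast
    qed
    then obtain e where e: "\<And>a. a \<in> Poly_Mapping.keys f \<Longrightarrow>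
        a = e a + sqfree_exp \<sigma> \<and> Poly_Mapping.keys (e a) \<subseteq> \<sigma>" by metis
    define g where
      "g = (\<Sum>a\<in>Poly_Mapping.keys f. Poly_Mapping.single (e a) (Poly_Mapping.lookup f a))"
    have "g * Poly_Mapping.single (sqfree_exp \<sigma>) 1 =
        (\<Sum>a\<in>Poly_Mapping.keys f. Poly_Mapping.single a (Poly_Mapping.lookup f a))"
      unfolding g_def sum_distrib_right using e by (intro sum.cong) (auto simp: mult_single)
    then have "f = g * Poly_Mapping.single (sqfree_exp \<sigma>) 1"
      using poly_mapping_eq_sum_single[of f] by simp
    moreover have "g \<in> K[\<sigma>]"
    proof -
      have "Poly_Mapping.keys x \<subseteq> \<sigma>" if x: "x \<in> Poly_Mapping.keys g" for x
      proof -
        have "\<exists>a\<in>Poly_Mapping.keys f. Poly_Mapping.lookup (Poly_Mapping.single (e a) (Poly_Mapping.lookup f a)) x \<noteq> 0"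
          using x unfolding in_keys_iff g_def lookup_sum by (metis (no_types, lifting) sum.neutral)
        then show ?thesis using e by (auto simp: lookup_single when_def split: if_splits)
      qed
      then show ?thesis by (simp add: polys_in_def)
    qed
    ultimately show "f \<in> ?L" unfolding stanley_set_def by blast
  qed
qed


section \<open>The lower bound\<close>

text \<open>
  Spaces spanned by disjoint families of monomials are independent, and they sum to the space spanned
  by the union: the component of \<open>f\<close> in the \<open>i\<close>-th space is the part of \<open>f\<close> supported on \<open>T i\<close>.
\<close>

lemma bij_betw_sum_disjoint_keys:
  fixes T :: "nat \<Rightarrow> 'a set"
  assumes disj: "disjoint_family_on T {..<n}"
  shows "bij_betw (\<lambda>w. \<Sum>i<n. w i)
    (\<Pi>\<^sub>E i\<in>{..<n}. {f :: 'a \<Rightarrow>\<^sub>0 'b::comm_monoid_add. Poly_Mapping.keys f \<subseteq> T i})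
    {f. Poly_Mapping.keys f \<subseteq> (\<Union>i<n. T i)}"
    (is "bij_betw ?sum ?P ?Q")
proof -
  have lookup: "Poly_Mapping.lookup (?sum w) a = Poly_Mapping.lookup (w j) a"
    if "w \<in> ?P" "j < n" "a \<in> T j" for w j a
  proof -
    have "Poly_Mapping.lookup (w i) a = 0" if "i < n" "i \<noteq> j" for i
    proof -
      have "a \<notin> T i" using disj \<open>j < n\<close> \<open>a \<in> T j\<close> that by (auto simp: disjoint_family_on_def)
      moreover have "Poly_Mapping.keys (w i) \<subseteq> T i" using \<open>w \<in> ?P\<close> \<open>i < n\<close> by (auto simp: PiE_iff)
      ultimately show ?thesis by (auto simp: in_keys_iff)
    qed
    then have "(\<Sum>i<n. Poly_Mapping.lookup (w i) a) = (\<Sum>i\<in>{j}. Poly_Mapping.lookup (w i) a)"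
      using \<open>j < n\<close> by (intro sum.mono_neutral_right) auto
    then show ?thesis by (simp add: lookup_sum)
  qed
  have inj: "inj_on ?sum ?P"
  proof (rule inj_onI)
    fix w w' assume w: "w \<in> ?P" "w' \<in> ?P" and eq: "?sum w = ?sum w'"
    show "w = w'"
    proof (rule PiE_ext[OF w])
      fix j assume j: "j \<in> {..<n}"
      show "w j = w' j"
      proof (rule poly_mapping_eqI)
        fix a
        show "Poly_Mapping.lookup (w j) a = Poly_Mapping.lookup (w' j) a"
        proof (cases "a \<in> T j")
          case True
          then show ?thesis using lookup[of w j a] lookup[of w' j a] w j eq by simp
        next
          case False
          then have "a \<notin> Poly_Mapping.keys (w j)" "a \<notin> Poly_Mapping.keys (w' j)"
            using w j by (auto simp: PiE_iff)
          then show ?thesis by (simp add: in_keys_iff)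
        qed
      qed
    qed
  qed
  have into: "?sum w \<in> ?Q" if w: "w \<in> ?P" for w
  proof -
    have "\<exists>i<n. a \<in> T i" if "a \<in> Poly_Mapping.keys (?sum w)" for a
    proof -
      obtain i where "i < n" "Poly_Mapping.lookup (w i) a \<noteq> 0"
        using \<open>a \<in> _\<close> unfolding in_keys_iff lookup_sum by (metis (no_types, lifting) lessThan_iff sum.neutral)
      moreover from this have "a \<in> T i" using PiE_mem[OF w, of i] by (auto simp: in_keys_iff)
      ultimately show ?thesis by blast
    qed
    then show ?thesis by auto
  qed
  have onto: "f \<in> ?sum ` ?P" if f: "f \<in> ?Q" for f
  proof -
    define w where "w = (\<lambda>i\<in>{..<n}. \<Sum>a\<in>Poly_Mapping.keys f \<inter> T i.
      Poly_Mapping.single a (Poly_Mapping.lookup f a))"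
    have lw: "Poly_Mapping.lookup (w i) a = (if a \<in> T i then Poly_Mapping.lookup f a else 0)"
      if "i < n" for i a
      using that by (auto simp: w_def lookup_sum lookup_single when_def in_keys_iff)
    have w: "w \<in> ?P"
    proof (rule PiE_I)
      show "w i \<in> {f. Poly_Mapping.keys f \<subseteq> T i}" if "i \<in> {..<n}" for i
        using lw[of i] that by (auto simp: in_keys_iff split: if_splits)
      show "w i = undefined" if "i \<notin> {..<n}" for i
        using that by (simp add: w_def)
    qed
    have "?sum w = f"
    proof (rule poly_mapping_eqI)
      fix a
      show "Poly_Mapping.lookup (?sum w) a = Poly_Mapping.lookup f a"
      proof (cases "a \<in> (\<Union>i<n. T i)")
        case True
        then show ?thesis using lookup[OF w] lw by auto
      next
        case False
        then have "a \<notin> Poly_Mapping.keys f" "a \<notin> Poly_Mapping.keys (?sum w)"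
          using f into[OF w] by auto
        then show ?thesis by (simp add: in_keys_iff)
      qed
    qed
    with w show ?thesis by blast
  qed
  show ?thesis
    using inj into onto by (auto simp: bij_betw_def)
qed

lemma support_decomposition:
  fixes E :: "'v::finite set set" and xs :: "'v set list"
  assumes xs: "distinct xs" "set xs = {\<sigma>. \<exists>F\<in>E. F \<subseteq> \<sigma>}"
  shows "stanley_decomposition (*)
    (\<lambda>a. edge_ideal E \<inter> mdeg_part a) (edge_ideal E :: ('v, 'k::field) mpoly set)
    (map (\<lambda>\<sigma>. (Poly_Mapping.single (sqfree_exp \<sigma>) 1, \<sigma>)) xs)"
    (is "stanley_decomposition _ _ _ ?D")
proof -
  let ?T = "\<lambda>i. {a :: 'v \<Rightarrow>\<^sub>0 nat. Poly_Mapping.keys a = xs ! i}"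
  have disj: "disjoint_family_on ?T {..<length xs}"
    using xs(1) by (auto simp: disjoint_family_on_def nth_eq_iff_index_eq)
  have "(\<Union>i<length xs. ?T i) = {a. Poly_Mapping.keys a \<in> set xs}"
    by (auto simp: in_set_conv_nth)
  then have I: "{f. Poly_Mapping.keys f \<subseteq> (\<Union>i<length xs. ?T i)} =
      (edge_ideal E :: ('v, 'k) mpoly set)"
    by (auto simp: xs(2) mem_edge_ideal_iff)
  have "(\<Pi>\<^sub>E i\<in>{..<length ?D}. stanley_set (*) (fst (?D ! i)) (snd (?D ! i))) =
      (\<Pi>\<^sub>E i\<in>{..<length xs}. {f :: ('v, 'k) mpoly. Poly_Mapping.keys f \<subseteq> ?T i})"
    unfolding length_map by (rule PiE_cong) (simp add: stanley_set_sqfree)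
  then have "bij_betw (\<lambda>w. \<Sum>i<length ?D. w i)
      (\<Pi>\<^sub>E i\<in>{..<length ?D}. stanley_set (*) (fst (?D ! i)) (snd (?D ! i)))
      (edge_ideal E :: ('v, 'k) mpoly set)"
    using bij_betw_sum_disjoint_keys[OF disj, where ?'b='k] unfolding I by simp
  moreover have "Poly_Mapping.single (sqfree_exp \<sigma>) (1::'k) \<in> edge_ideal E" if "\<sigma> \<in> set xs" for \<sigma>
    using that by (simp add: xs(2) single_mem_edge_ideal_iff keys_sqfree_exp)
  moreover have "Poly_Mapping.single b (1::'k) \<in> mdeg_part (\<lambda>v. int (Poly_Mapping.lookup b v))" for b :: "'v \<Rightarrow>\<^sub>0 nat"
    by (simp add: mdeg_part_def)
  ultimately show ?thesis
    unfolding stanley_decomposition_def by (auto simp: free_over_monomial)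
qed

text \<open>
  The empty decomposition describes the zero module. Excluding it makes every minimum in the
  definition of Stanley depth a minimum over a nonempty set.
\<close>

lemma decomposition_nonempty:
  fixes E :: "'v::finite set set"
  assumes "E \<noteq> {}"
    and "stanley_decomposition (*) G (edge_ideal E :: ('v, 'k::field) mpoly set) D"
  shows "D \<noteq> []"
proof
  assume "D = []"
  with assms(2) have "(edge_ideal E :: ('v, 'k) mpoly set) = {0}"
    by (simp add: stanley_decomposition_def bij_betw_def)
  moreover obtain F where "F \<in> E" using assms(1) by blast
  then have "Poly_Mapping.single (sqfree_exp F) (1::'k) \<in> edge_ideal E"
    by (auto simp: single_mem_edge_ideal_iff keys_sqfree_exp)
  ultimately show False
    by (metis keys_single keys_zero one_neq_zero singletonD insert_not_empty)
qed

lemma sdepth_decomposition_le: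
  assumes "(u, Z) \<in> set D"
  shows "sdepth_decomposition D \<le> card Z"
  unfolding sdepth_decomposition_def using assms by (intro Min_le) force+

text \<open>
  The dimension of each space is at most the number of vertices; finiteness makes the maximum that
  defines the Stanley depth an upper bound and an attained value.
\<close>

lemma finite_sdepths:
  fixes E :: "'v::finite set set"
  assumes "E \<noteq> {}"
  shows "finite {sdepth_decomposition D | D.
    stanley_decomposition (*) G (edge_ideal E :: ('v, 'k::field) mpoly set) D}"
proof (rule finite_subset)
  show "{sdepth_decomposition D | D.
      stanley_decomposition (*) G (edge_ideal E :: ('v, 'k) mpoly set) D} \<subseteq> {..card (UNIV :: 'v set)}"
  proof clarsimp
    fix D assume "stanley_decomposition (*) G (edge_ideal E :: ('v, 'k) mpoly set) D"
    then obtain u Z where "(u, Z) \<in> set D"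
      using decomposition_nonempty[OF assms] by (metis list.set_intros(1) neq_Nil_conv surj_pair)
    then show "sdepth_decomposition D \<le> card (UNIV :: 'v set)"
      using sdepth_decomposition_le by (metis card_mono finite order_trans subset_UNIV)
  qed
qed simp

lemma sdepth_edge_ideal_ge:
  fixes E :: "'v::finite set set"
  assumes E: "E \<noteq> {}" and card: "\<And>F. F \<in> E \<Longrightarrow> s \<le> card F"
  shows "s \<le> sdepth_ideal (edge_ideal E :: ('v, 'k::field) mpoly set)"
proof -
  obtain xs where xs: "distinct xs" "set xs = {\<sigma>. \<exists>F\<in>E. F \<subseteq> \<sigma>}"
    using finite_distinct_list[of "{\<sigma>. \<exists>F\<in>E. F \<subseteq> \<sigma>}"] by auto
  let ?D = "map (\<lambda>\<sigma>. (Poly_Mapping.single (sqfree_exp \<sigma>) (1::'k), \<sigma>)) xs"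
  note D = support_decomposition[OF xs, where ?'k='k]
  have "xs \<noteq> []" using decomposition_nonempty[OF E D] by simp
  moreover have "s \<le> card \<sigma>" if \<sigma>: "\<sigma> \<in> set xs" for \<sigma>
  proof -
    obtain F where "F \<in> E" "F \<subseteq> \<sigma>" using \<sigma> xs(2) by auto
    then show ?thesis using card[of F] card_mono[of \<sigma> F] by simp
  qed
  ultimately have "s \<le> sdepth_decomposition ?D"
    by (auto simp: sdepth_decomposition_def)
  also have "\<dots> \<le> sdepth_ideal (edge_ideal E :: ('v, 'k) mpoly set)"
    unfolding sdepth_def by (rule Max_ge[OF finite_sdepths[OF E]]) (use D in blast)
  finally show ?thesis .
qed


section \<open>The upper bound\<close>

text \<open>
  A nonzero element of two different summands would have two representations, one in each summand.
\<close>

lemma decomposition_disjoint: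
  fixes D :: "(('v::finite, 'k::field) mpoly \<times> 'v set) list"
  assumes D: "stanley_decomposition (*) G M D"
    and ij: "i < length D" "j < length D"
    and f: "f \<in> stanley_set (*) (fst (D ! i)) (snd (D ! i))"
      "f \<in> stanley_set (*) (fst (D ! j)) (snd (D ! j))" "f \<noteq> 0"
  shows "i = j"
proof -
  let ?P = "\<Pi>\<^sub>E k\<in>{..<length D}. stanley_set (*) (fst (D ! k)) (snd (D ! k))"
  \<comment> \<open>\<open>w l\<close> represents \<open>f\<close> by putting it entirely into the \<open>l\<close>-th summand.\<close>
  define w where "w = (\<lambda>l. \<lambda>k\<in>{..<length D}. if k = l then f else 0)"
  have "inj_on (\<lambda>w. \<Sum>k<length D. w k) ?P"
    using D by (simp add: stanley_decomposition_def bij_betw_def)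
  moreover have "w i \<in> ?P" "w j \<in> ?P"
    using f by (auto simp: w_def zero_mem_stanley_set)
  moreover have "(\<Sum>k<length D. w i k) = f" "(\<Sum>k<length D. w j k) = f"
    using ij by (simp_all add: w_def)
  ultimately have "w i = w j" by (auto dest: inj_onD)
  then have "w i i = w j i" by simp
  then show ?thesis using ij f(3) by (simp add: w_def split: if_splits)
qed

text \<open>
  When no edge contains another, \<open>x\<^sup>F\<close> is a minimal generator. Some component of its decomposition
  involves \<open>x\<^sup>F\<close>, so the homogeneous element spanning that summand divides \<open>x\<^sup>F\<close>; as it lies in the
  ideal, minimality forces it to be a scalar multiple of \<open>x\<^sup>F\<close>.
\<close>

lemma generator_in_decomposition:
  fixes E :: "'v::finite set set"
  assumes E: "\<And>F F'. F \<in> E \<Longrightarrow> F' \<in> E \<Longrightarrow> F' \<subseteq> F \<Longrightarrow> F' = F"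
    and D: "stanley_decomposition (*) (\<lambda>a. edge_ideal E \<inter> mdeg_part a)
      (edge_ideal E :: ('v, 'k::field) mpoly set) D"
    and F: "F \<in> E"
  shows "\<exists>i<length D. \<exists>c. c \<noteq> 0 \<and> fst (D ! i) = Poly_Mapping.single (sqfree_exp F) c"
proof -
  let ?P = "\<Pi>\<^sub>E k\<in>{..<length D}. stanley_set (*) (fst (D ! k)) (snd (D ! k))"
  have "Poly_Mapping.single (sqfree_exp F) (1::'k) \<in> edge_ideal E"
    using F by (auto simp: single_mem_edge_ideal_iff keys_sqfree_exp)
  then obtain w where w: "w \<in> ?P" and
    sum: "(\<Sum>k<length D. w k) = Poly_Mapping.single (sqfree_exp F) (1::'k)"
    using D unfolding stanley_decomposition_def bij_betw_def by (metis (no_types, lifting) imageE)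
  have "(\<Sum>k<length D. Poly_Mapping.lookup (w k) (sqfree_exp F)) = 1"
    using arg_cong[OF sum, of "\<lambda>f. Poly_Mapping.lookup f (sqfree_exp F)"] by (simp add: lookup_sum)
  then obtain i where i: "i < length D" "sqfree_exp F \<in> Poly_Mapping.keys (w i)"
    by (metis (no_types, lifting) in_keys_iff lessThan_iff sum.neutral zero_neq_one)
  obtain u Z where uZ: "D ! i = (u, Z)" by fastforce
  with i(1) D have u: "u \<in> edge_ideal E" "\<exists>a. u \<in> mdeg_part a"
    unfolding stanley_decomposition_def using nth_mem[of i D] by auto
  then obtain b c where bc: "u = Poly_Mapping.single b c" using homogeneous_eq_single by metis
  have wi: "w i \<in> stanley_set (*) (Poly_Mapping.single b c) Z"
    using PiE_mem[OF w, of i] i(1) uZ bc by simp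
  have "c \<noteq> 0"
  proof
    assume "c = 0"
    then have "w i = 0" using wi by (auto simp: stanley_set_def)
    then show False using i(2) by simp
  qed
  obtain e where e: "sqfree_exp F = e + b" using keys_stanley_set[OF wi i(2)] by metis
  obtain F' where F': "F' \<in> E" "F' \<subseteq> Poly_Mapping.keys b"
    using u(1) \<open>c \<noteq> 0\<close> by (auto simp: bc single_mem_edge_ideal_iff)
  have "Poly_Mapping.keys b \<subseteq> Poly_Mapping.keys (sqfree_exp F)"
    unfolding e by (auto simp: in_keys_iff lookup_add)
  then have "F' = F" using E[OF F F'(1)] F'(2) by (simp add: keys_sqfree_exp)
  \<comment> \<open>\<open>b\<close> is squarefree because it divides \<open>x\<^sup>F\<close>, and its support contains \<open>F\<close>.\<close>
  have "b = sqfree_exp F"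
  proof (rule poly_mapping_eqI)
    fix v
    have "Poly_Mapping.lookup (sqfree_exp F) v = Poly_Mapping.lookup e v + Poly_Mapping.lookup b v"
      by (simp add: e lookup_add)
    then show "Poly_Mapping.lookup b v = Poly_Mapping.lookup (sqfree_exp F) v"
      using F'(2) \<open>F' = F\<close> by (cases "v \<in> F") (auto simp: lookup_sqfree_exp in_keys_iff)
  qed
  then have "fst (D ! i) = Poly_Mapping.single (sqfree_exp F) c" using uZ bc by simp
  with i(1) \<open>c \<noteq> 0\<close> show ?thesis by blast
qed

text \<open>
  The counting step. Let \<open>Z F\<close> be the variable set of the summand spanned by \<open>x\<^sup>F\<close>. The pairs of an
  edge \<open>F\<close> and a vertex \<open>v \<in> Z F - F\<close> inject into the \<open>(s + 1)\<close>-sets above an edge: if two pairs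
  give the same set, the corresponding squarefree monomial lies in both summands, so these coincide.
\<close>

lemma sdepth_decomposition_bound:
  fixes E :: "'v::finite set set"
  assumes card: "\<And>F. F \<in> E \<Longrightarrow> card F = s"
    and D: "stanley_decomposition (*) (\<lambda>a. edge_ideal E \<inter> mdeg_part a)
      (edge_ideal E :: ('v, 'k::field) mpoly set) D"
  shows "(sdepth_decomposition D - s) * card E \<le> card {G. card G = Suc s \<and> (\<exists>F\<in>E. F \<subseteq> G)}"
proof -
  have "F' = F" if "F \<in> E" "F' \<in> E" "F' \<subseteq> F" for F F'
    using that card by (metis card_subset_eq finite)
  from generator_in_decomposition[OF this D]
  obtain i c where i: "\<And>F. F \<in> E \<Longrightarrow> i F < length D" and c: "\<And>F. F \<in> E \<Longrightarrow> c F \<noteq> 0"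
    and u: "\<And>F. F \<in> E \<Longrightarrow> fst (D ! i F) = Poly_Mapping.single (sqfree_exp F) (c F)"
    by metis
  define Z where "Z F = snd (D ! i F)" for F
  let ?P = "SIGMA F:E. Z F - F"
  have new: "Poly_Mapping.single (sqfree_exp (insert v F)) 1 \<in>
      stanley_set (*) (fst (D ! i F)) (snd (D ! i F))" if "F \<in> E" "v \<in> Z F - F" for F v
    using that c by (auto simp: u sqfree_exp_insert Z_def intro!: single_mem_stanley_set)
  have inj: "inj_on (\<lambda>(F, v). insert v F) ?P"
  proof (rule inj_onI, clarify)
    fix F v F' v'
    assume F: "F \<in> E" "v \<in> Z F" "v \<notin> F" and F': "F' \<in> E" "v' \<in> Z F'" "v' \<notin> F'"
      and eq: "insert v F = insert v' F'"
    have "i F = i F'"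
      using decomposition_disjoint[OF D i[OF F(1)] i[OF F'(1)] new[of F v]] new[of F' v'] F F' eq
      by (simp add: single_eq_zero_iff)
    then have "sqfree_exp F = sqfree_exp F'"
      using u[OF F(1)] u[OF F'(1)] c[OF F(1)] c[OF F'(1)] by (metis keys_single singleton_inject)
    then have "F = F'" by (metis keys_sqfree_exp finite)
    then show "F = F' \<and> v = v'" using eq F F' by blast
  qed
  have "sdepth_decomposition D - s \<le> card (Z F - F)" if "F \<in> E" for F
  proof -
    have "sdepth_decomposition D \<le> card (Z F)"
      using nth_mem[OF i[OF that]] by (intro sdepth_decomposition_le[of "fst (D ! i F)"]) (simp add: Z_def)
    also have "card (Z F) - s \<le> card (Z F - F)"
      using diff_card_le_card_Diff[of F "Z F"] card[OF that] by simp
    finally show ?thesis by simp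
  qed
  then have "(sdepth_decomposition D - s) * card E \<le> (\<Sum>F\<in>E. card (Z F - F))"
    using sum_bounded_below[of E "sdepth_decomposition D - s" "\<lambda>F. card (Z F - F)"]
    by (simp add: mult.commute)
  also have "\<dots> = card ((\<lambda>(F, v). insert v F) ` ?P)"
    by (simp add: card_image[OF inj] card_SigmaI)
  also have "\<dots> \<le> card {G. card G = Suc s \<and> (\<exists>F\<in>E. F \<subseteq> G)}"
    by (intro card_mono) (auto simp: card)
  finally show ?thesis .
qed

lemma sdepth_edge_ideal_bound:
  fixes E :: "'v::finite set set"
  assumes E: "E \<noteq> {}" and card: "\<And>F. F \<in> E \<Longrightarrow> card F = s"
  shows "(sdepth_ideal (edge_ideal E :: ('v, 'k::field) mpoly set) - s) * card E
    \<le> card {G. card G = Suc s \<and> (\<exists>F\<in>E. F \<subseteq> G)}"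
proof -
  let ?S = "{sdepth_decomposition D | D. stanley_decomposition (*) (\<lambda>a. edge_ideal E \<inter> mdeg_part a)
      (edge_ideal E :: ('v, 'k) mpoly set) D}"
  obtain xs where "distinct xs" "set xs = {\<sigma>. \<exists>F\<in>E. F \<subseteq> \<sigma>}"
    using finite_distinct_list[of "{\<sigma>. \<exists>F\<in>E. F \<subseteq> \<sigma>}"] by auto
  from support_decomposition[OF this, where ?'k='k] have "?S \<noteq> {}" by blast
  then have "Max ?S \<in> ?S" by (rule Max_in[OF finite_sdepths[OF E]])
  then show ?thesis
    unfolding sdepth_def using sdepth_decomposition_bound[OF card] by force
qed


section \<open>Complete bipartite hypergraphs\<close>

lemma mem_complete_bipartite_edges_iff:
  "F \<in> complete_bipartite_edges s V1 V2 \<longleftrightarrow>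
    F \<subseteq> V1 \<union> V2 \<and> card F = s \<and> \<not> F \<subseteq> V1 \<and> \<not> F \<subseteq> V2"
  by (auto simp: complete_bipartite_edges_def)

lemma card_complete_bipartite_edges:
  assumes fin: "finite V1" "finite V2" and disj: "V1 \<inter> V2 = {}" and "0 < s"
  shows "real (card (complete_bipartite_edges s V1 V2)) =
    real (card (V1 \<union> V2) choose s) - real (card V1 choose s) - real (card V2 choose s)"
proof -
  let ?S = "\<lambda>A. {F. F \<subseteq> A \<and> card F = s}"
  let ?E = "complete_bipartite_edges s V1 V2"
  have finite: "finite (?S A)" if "finite A" for A :: "'a set"
    using that by simp
  have "F = {}" if "F \<subseteq> V1" "F \<subseteq> V2" for F
    using that disj by blast
  then have "?S V1 \<inter> ?S V2 = {}"
    using \<open>0 < s\<close> by (metis (mono_tags, lifting) Int_emptyI card.empty mem_Collect_eq not_less0)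
  moreover have "?S (V1 \<union> V2) = (?S V1 \<union> ?S V2) \<union> ?E"
    by (auto simp: mem_complete_bipartite_edges_iff)
  moreover have "finite ?E"
    by (rule finite_subset[OF _ finite[of "V1 \<union> V2"]])
      (use fin in \<open>auto simp: mem_complete_bipartite_edges_iff\<close>)
  moreover have "(?S V1 \<union> ?S V2) \<inter> ?E = {}"
    by (auto simp: mem_complete_bipartite_edges_iff)
  ultimately have "card (?S (V1 \<union> V2)) = card (?S V1) + card (?S V2) + card ?E"
    using finite fin by (simp add: card_Un_disjoint)
  then show ?thesis using fin by (simp add: n_subsets)
qed

text \<open>
  A set that lies in neither part contains a vertex outside \<open>V1\<close> and one outside \<open>V2\<close>. Since
  \<open>2 \<le> s\<close>, both can be kept while the set is shrunk to size \<open>s\<close>.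
\<close>

lemma exists_complete_bipartite_subedge:
  assumes "G \<subseteq> V1 \<union> V2" "\<not> G \<subseteq> V1" "\<not> G \<subseteq> V2" "V1 \<inter> V2 = {}"
    and "finite G" "2 \<le> s" "s \<le> card G"
  shows "\<exists>F\<in>complete_bipartite_edges s V1 V2. F \<subseteq> G"
proof -
  obtain a b where ab: "a \<in> G" "a \<notin> V1" "b \<in> G" "b \<notin> V2" using assms by blast
  have "card {a, b} \<le> s" using assms(6) by (cases "a = b") auto
  moreover have "{a, b} \<subseteq> G" using ab by simp
  ultimately obtain F where "{a, b} \<subseteq> F" "F \<subseteq> G" "card F = s"
    using exists_subset_between[of "{a, b}" s G] assms by metis
  then have "F \<in> complete_bipartite_edges s V1 V2"
    using ab assms(1) by (auto simp: mem_complete_bipartite_edges_iff)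
  with \<open>F \<subseteq> G\<close> show ?thesis by blast
qed

lemma upset_complete_bipartite_edges:
  fixes V1 V2 :: "'v::finite set"
  assumes "V1 \<union> V2 = UNIV" "V1 \<inter> V2 = {}" "2 \<le> s" "s \<le> t"
  shows "{G. card G = t \<and> (\<exists>F\<in>complete_bipartite_edges s V1 V2. F \<subseteq> G)} =
    complete_bipartite_edges t V1 V2"
proof (intro equalityI subsetI)
  fix G assume "G \<in> complete_bipartite_edges t V1 V2"
  then show "G \<in> {G. card G = t \<and> (\<exists>F\<in>complete_bipartite_edges s V1 V2. F \<subseteq> G)}"
    using assms exists_complete_bipartite_subedge[of G V1 V2 s]
    by (auto simp: mem_complete_bipartite_edges_iff)
next
  fix G assume "G \<in> {G. card G = t \<and> (\<exists>F\<in>complete_bipartite_edges s V1 V2. F \<subseteq> G)}"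
  then obtain F where "card G = t" "F \<subseteq> G" "\<not> F \<subseteq> V1" "\<not> F \<subseteq> V2"
    by (auto simp: mem_complete_bipartite_edges_iff)
  then show "G \<in> complete_bipartite_edges t V1 V2"
    using assms(1) by (simp add: mem_complete_bipartite_edges_iff) blast
qed

theorem theorem3p4:
  fixes V V1 V2 :: "'v::finite set" and s :: nat and I :: "('v, 'k::field) mpoly set"
  assumes "V = UNIV"
    and "V = V1 \<union> V2" and "V1 \<inter> V2 = {}" and "V1 \<noteq> {}" and "V2 \<noteq> {}"
    and "2 \<le> s" and "s \<le> card V"
    and "I = edge_ideal (complete_bipartite_edges s V1 V2)"
  shows "s \<le> sdepth_ideal I \<and>
    real (sdepth_ideal I) \<le> real s +
      (real (card V choose (s + 1)) - real (card V1 choose (s + 1)) - real (card V2 choose (s + 1))) /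
      (real (card V choose s) - real (card V1 choose s) - real (card V2 choose s))"
proof -
  let ?E = "\<lambda>t. complete_bipartite_edges t V1 V2"
  have card: "\<And>F. F \<in> ?E s \<Longrightarrow> card F = s"
    by (simp add: mem_complete_bipartite_edges_iff)
  have "\<not> V \<subseteq> V1" "\<not> V \<subseteq> V2"
    using assms by auto
  then have ne: "?E s \<noteq> {}"
    using exists_complete_bipartite_subedge[of V V1 V2 s] assms by auto
  then have pos: "0 < card (?E s)" by (simp add: card_gt_0_iff)
  have lower: "s \<le> sdepth_ideal I"
    using sdepth_edge_ideal_ge[OF ne, of s] card assms(8) by simp
  have "(sdepth_ideal I - s) * card (?E s) \<le> card (?E (Suc s))"
    using sdepth_edge_ideal_bound[OF ne card, where ?'k='k]
      upset_complete_bipartite_edges[of V1 V2 s "Suc s"] assms by simp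
  then have "real ((sdepth_ideal I - s) * card (?E s)) \<le> real (card (?E (Suc s)))"
    by (simp only: of_nat_le_iff)
  then have "(real (sdepth_ideal I) - real s) * real (card (?E s)) \<le> real (card (?E (Suc s)))"
    using lower by (simp add: of_nat_diff)
  then have "real (sdepth_ideal I) - real s \<le> real (card (?E (Suc s))) / real (card (?E s))"
    using pos by (simp add: pos_le_divide_eq)
  then have "real (sdepth_ideal I) \<le> real s + real (card (?E (Suc s))) / real (card (?E s))"
    by simp
  then show ?thesis
    using lower assms(2,3,6) by (simp add: card_complete_bipartite_edges)
qed

end
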